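(* Let $\mathscr P=\{x_1,\ldots,x_n\}$ be a poset and let $\{P_1,\ldots,P_n\}$ and $\{Q_1,\ldots,Q_n\}$ be two sequences of posets such that $P_i\sim Q_i$ for every $i$. Then $$\mathscr P[x_k\to P_k]_{k=1}^n\sim\mathscr P[x_k\to Q_k]_{k=1}^n.$$
   Context: All posets are finite. $F_P(m)$ is the number of order-preserving maps $f:P\to\{1,\dots,m\}$ (i.e. $f(a)\le f(b)$ whenever $a\le b$); it is a polynomial in $m$. Write $P\sim Q$ ("$P$ and $Q$ are doppelgangers") when $F_P=F_Q$. For a poset $\mathscr P=\{x_1,\dots,x_n\}$ and posets $P_1,\dots,P_n$, the Ur-operation $\mathscr P[x_k\to P_k]_{k=1}^n$ is the poset on the disjoint union $\bigcup_k P_k$ in which, for $p\in P_j$ and $q\in P_k$, $p\le q$ holds iff either $j=k$ and $p\le q$ in $P_j$, or $j\ne k$ and $x_j\le x_k$ in $\mathscr P$. *)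

theory Defs
  imports Main "HOL-Library.FuncSet"
begin

type_synonym 'a poset = "'a set \<times> 'a rel"

definition finite_poset :: "'a poset \<Rightarrow> bool" where
  "finite_poset P \<longleftrightarrow> finite (fst P) \<and> partial_order_on (fst P) (snd P)"

text \<open>
  Maps are taken extensional, so that each map on the carrier is counted exactly once.
\<close>

definition order_preserving_maps :: "'a poset \<Rightarrow> nat \<Rightarrow> ('a \<Rightarrow> nat) set" where
  "order_preserving_maps P m =
     {f \<in> fst P \<rightarrow>\<^sub>E {1..m}. monotone_on (fst P) (\<lambda>a b. (a, b) \<in> snd P) (\<le>) f}"

definition order_polynomial :: "'a poset \<Rightarrow> nat \<Rightarrow> nat" where
  "order_polynomial P m = card (order_preserving_maps P m)"

text \<open>
  Equality of the counting functions on all naturals. Including \<open>m = 0\<close> is harmless: the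
  count there is 1 for the empty poset and 0 otherwise, as is the value of the polynomial.
\<close>

definition doppelgangers :: "'a poset \<Rightarrow> 'b poset \<Rightarrow> bool"  (infix "\<sim>\<^sub>d" 50) where
  "P \<sim>\<^sub>d Q \<longleftrightarrow> order_polynomial P = order_polynomial Q"

text \<open>
  The base poset \<open>X\<close> enters through its order relation and an enumeration \<open>x 1, \<dots>, x n\<close>
  of its carrier; the disjoint union of the \<open>P k\<close> consists of pairs \<open>(k, p)\<close> with \<open>p\<close> in \<open>P k\<close>.
\<close>

definition ur_operation :: "'c poset \<Rightarrow> nat \<Rightarrow> (nat \<Rightarrow> 'c) \<Rightarrow> (nat \<Rightarrow> 'a poset) \<Rightarrow> (nat \<times> 'a) poset" where
  "ur_operation X n x P =
     (let S = (SIGMA k:{1..n}. fst (P k)) in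
      (S, {((j, p), (k, q)) | j p k q. (j, p) \<in> S \<and> (k, q) \<in> S \<and>
             (j = k \<and> (p, q) \<in> snd (P j) \<or> j \<noteq> k \<and> (x j, x k) \<in> snd X)}))"

lemma finite_poset_ur_operation:
  assumes X: "finite_poset X" and x: "bij_betw x {1..n} (fst X)"
    and P: "\<And>k. k \<in> {1..n} \<Longrightarrow> finite_poset (P k)"
  shows "finite_poset (ur_operation X n x P)"
proof -
  let ?U = "ur_operation X n x P"
  have aX: "antisym (snd X)" and tX: "trans (snd X)"
    using X by (auto simp: finite_poset_def partial_order_on_def preorder_on_def)
  have aP: "antisym (snd (P k))" and tP: "trans (snd (P k))"
    and rP: "refl_on (fst (P k)) (snd (P k))" and fP: "finite (fst (P k))" if "k \<in> {1..n}" for k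
    using P[OF that] by (auto simp: finite_poset_def partial_order_on_def preorder_on_def)
  have inj: "j = k" if "(x j, x k) \<in> snd X" "(x k, x j) \<in> snd X" "j \<in> {1..n}" "k \<in> {1..n}" for j k
    using that x aX by (meson antisymD bij_betw_imp_inj_on inj_onD)
  have le: "((j, p), (k, q)) \<in> snd ?U \<longleftrightarrow> j \<in> {1..n} \<and> k \<in> {1..n} \<and> p \<in> fst (P j) \<and> q \<in> fst (P k) \<and>
      (j = k \<and> (p, q) \<in> snd (P j) \<or> j \<noteq> k \<and> (x j, x k) \<in> snd X)" for j p k q
    by (auto simp: ur_operation_def Let_def)
  have "finite (fst ?U)"
    using fP by (auto simp: ur_operation_def Let_def)
  moreover have "snd ?U \<subseteq> fst ?U \<times> fst ?U"
    by (auto simp: ur_operation_def Let_def)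
  moreover have "refl_on (fst ?U) (snd ?U)"
    using rP by (auto simp: ur_operation_def Let_def refl_on_def)
  moreover have "antisym (snd ?U)"
  proof (rule antisymI)
    fix u v assume "(u, v) \<in> snd ?U" "(v, u) \<in> snd ?U"
    then show "u = v"
      by (cases u; cases v) (use inj aP in \<open>auto simp: le dest: antisymD\<close>)
  qed
  moreover have "trans (snd ?U)"
  proof (rule transI)
    fix u v w assume 1: "(u, v) \<in> snd ?U" and 2: "(v, w) \<in> snd ?U"
    obtain j p k q l r where [simp]: "u = (j, p)" "v = (k, q)" "w = (l, r)"
      by (cases u; cases v; cases w)
    show "(u, w) \<in> snd ?U"
      using 1 2 inj[of j k] transD[OF tP[of j], of p q r] transD[OF tX, of "x j" "x k" "x l"]
      unfolding \<open>u = _\<close> \<open>v = _\<close> \<open>w = _\<close> le by metis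
  qed
  ultimately show ?thesis
    by (auto simp: finite_poset_def partial_order_on_def preorder_on_def)
qed

end

theory Submission
  imports Defs "HOL-Library.Infinite_Set"
begin

text \<open>
  The idea is to refine the count of order-preserving maps by their images. A finite set \<open>S\<close> of
  naturals is, as a chain, isomorphic to \<open>{1..card S}\<close>, so the order polynomial of \<open>P\<close> knows the
  number of order-preserving maps from \<open>P\<close> into \<open>S\<close>, and by inclusion-exclusion over the subsets
  of \<open>S\<close> it also knows the number of those with image exactly \<open>S\<close>
  (\<open>card_maps_onto_doppelgangers\<close>).

  A map \<open>f\<close> on an Ur-operation is a tuple of maps \<open>f\<^sub>k\<close> on the blocks. It is order-preserving iff
  every \<open>f\<^sub>k\<close> is and, whenever \<open>x\<^sub>j < x\<^sub>k\<close>, every value of \<open>f\<^sub>j\<close> is at most every value of \<open>f\<^sub>k\<close>.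
  The second condition sees only the images of the \<open>f\<^sub>k\<close>. Hence, summing over all tuples of
  images that satisfy it, the number of order-preserving maps is
  \<open>\<Sum>\<^sub>T \<Prod>\<^sub>k card (maps_onto (P k) (T k))\<close> (\<open>order_polynomial_ur_operation\<close>), and nothing in this
  formula changes when each \<open>P k\<close> is replaced by a doppelganger.
\<close>

definition maps_into :: "'a poset \<Rightarrow> nat set \<Rightarrow> ('a \<Rightarrow> nat) set" where
  "maps_into P S = {f \<in> fst P \<rightarrow>\<^sub>E S. monotone_on (fst P) (\<lambda>a b. (a, b) \<in> snd P) (\<le>) f}"

definition maps_onto :: "'a poset \<Rightarrow> nat set \<Rightarrow> ('a \<Rightarrow> nat) set" where
  "maps_onto P S = {f \<in> maps_into P S. f ` fst P = S}"

lemma finite_maps_into: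
  assumes "finite (fst P)" "finite S"
  shows "finite (maps_into P S)"
  by (rule finite_subset[of _ "fst P \<rightarrow>\<^sub>E S"])
    (use assms in \<open>auto simp: maps_into_def intro: finite_PiE\<close>)

lemma maps_onto_subset: "maps_onto P S \<subseteq> maps_into P S"
  by (auto simp: maps_onto_def)

lemma finite_maps_onto:
  assumes "finite (fst P)" "finite S"
  shows "finite (maps_onto P S)"
  using finite_subset[OF maps_onto_subset finite_maps_into[OF assms]] .

text \<open>
  Composition with an isomorphism of chains is a bijection of the sets of order-preserving maps;
  its inverse is composition with the inverse isomorphism.
\<close>

lemma bij_betw_maps_into_comp:
  assumes g: "bij_betw g A B" and mono: "strict_mono_on A g"
  shows "bij_betw (\<lambda>f. restrict (g \<circ> f) (fst P)) (maps_into P A) (maps_into P B)"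
proof (rule bij_betw_byWitness[where f' = "\<lambda>f. restrict (inv_into A g \<circ> f) (fst P)"])
  let ?h = "inv_into A g"
  have le: "g a \<le> g b \<longleftrightarrow> a \<le> b" if "a \<in> A" "b \<in> A" for a b
    using strict_mono_on_less_eq[OF mono] that by blast
  have gB: "g a \<in> B" if "a \<in> A" for a
    using g that by (auto simp: bij_betw_def)
  have hA: "?h b \<in> A" and gh: "g (?h b) = b" if "b \<in> B" for b
    using g that by (auto simp: bij_betw_def inv_into_into f_inv_into_f)
  have hg: "?h (g a) = a" if "a \<in> A" for a
    using g that by (auto simp: bij_betw_def)
  have hle: "?h a \<le> ?h b" if "a \<in> B" "b \<in> B" "a \<le> b" for a b
    using le[OF hA[OF that(1)] hA[OF that(2)]] gh that by simp
  show "\<forall>f\<in>maps_into P A. restrict (?h \<circ> restrict (g \<circ> f) (fst P)) (fst P) = f"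
    by (auto simp: maps_into_def fun_eq_iff restrict_def hg PiE_def Pi_def extensional_def)
  show "\<forall>f\<in>maps_into P B. restrict (g \<circ> restrict (?h \<circ> f) (fst P)) (fst P) = f"
    by (auto simp: maps_into_def fun_eq_iff restrict_def gh PiE_def Pi_def extensional_def)
  show "(\<lambda>f. restrict (g \<circ> f) (fst P)) ` maps_into P A \<subseteq> maps_into P B"
    by (auto simp: maps_into_def monotone_on_def PiE_def Pi_def le gB)
  show "(\<lambda>f. restrict (?h \<circ> f) (fst P)) ` maps_into P B \<subseteq> maps_into P A"
    by (auto simp: maps_into_def monotone_on_def PiE_def Pi_def hA hle)
qed

text \<open>
  Both \<open>S\<close> and \<open>{1..card S}\<close> are chains isomorphic to \<open>{..<card S}\<close>.
\<close>

lemma card_maps_into: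
  assumes "finite S"
  shows "card (maps_into P S) = order_polynomial P (card S)"
proof -
  have chain: "card (maps_into P {..<card A}) = card (maps_into P A)" if "finite A" for A
  proof -
    obtain g where "bij_betw g {..<card A} A" "strict_mono_on {..<card A} g"
      using ex_bij_betw_strict_mono_card[OF \<open>finite A\<close>] .
    then show ?thesis
      by (rule bij_betw_same_card[OF bij_betw_maps_into_comp])
  qed
  have "card (maps_into P S) = card (maps_into P {1..card S})"
    using chain[OF assms] chain[of "{1..card S}"] by simp
  then show ?thesis
    by (simp add: order_polynomial_def order_preserving_maps_def maps_into_def)
qed

lemma card_maps_into_eq_sum:
  assumes "finite (fst P)" "finite S"
  shows "card (maps_into P S) = (\<Sum>T\<in>Pow S. card (maps_onto P T))"
proof -
  have "maps_into P S = (\<Union>T\<in>Pow S. maps_onto P T)"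
    by (auto simp: maps_into_def maps_onto_def PiE_def Pi_def)
  moreover have "card (\<Union>T\<in>Pow S. maps_onto P T) = (\<Sum>T\<in>Pow S. card (maps_onto P T))"
  proof (intro card_UN_disjoint ballI impI)
    show "finite (maps_onto P T)" if "T \<in> Pow S" for T
      using that finite_maps_onto[OF assms(1)] finite_subset[OF _ assms(2)] by blast
  qed (use assms in \<open>auto simp: maps_onto_def\<close>)
  ultimately show ?thesis by simp
qed

lemma card_maps_into_split:
  assumes "finite (fst P)" "finite S"
  shows "card (maps_into P S) =
    card (maps_onto P S) + (\<Sum>T\<in>Pow S - {S}. card (maps_onto P T))"
  using card_maps_into_eq_sum[OF assms] \<open>finite S\<close> by (simp add: sum.remove[of "Pow S" S])

text \<open>
  This is inclusion-exclusion in recursive form: the maps onto \<open>S\<close> are the maps into \<open>S\<close>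
  without those onto a proper subset of \<open>S\<close>, which are counted by induction.
\<close>

lemma card_maps_onto_doppelgangers:
  assumes PQ: "P \<sim>\<^sub>d Q" and fin: "finite (fst P)" "finite (fst Q)" and "finite S"
  shows "card (maps_onto P S) = card (maps_onto Q S)"
  using \<open>finite S\<close>
proof (induction S rule: finite_psubset_induct)
  case (psubset S)
  have "(\<Sum>T\<in>Pow S - {S}. card (maps_onto P T)) = (\<Sum>T\<in>Pow S - {S}. card (maps_onto Q T))"
    by (rule sum.cong) (auto intro: psubset.IH)
  moreover have "card (maps_into P S) = card (maps_into Q S)"
    using PQ by (simp add: card_maps_into[OF psubset.hyps] doppelgangers_def)
  ultimately show ?case
    using card_maps_into_split[OF fin(1) psubset.hyps] card_maps_into_split[OF fin(2) psubset.hyps]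
    by simp
qed

text \<open>
  What order preservation between different blocks requires of the images of the block maps. Only
  the minimum and the maximum of each image matter, but with whole images an empty block, which
  has neither, needs no separate treatment.
\<close>

definition image_tuples :: "'c poset \<Rightarrow> nat \<Rightarrow> (nat \<Rightarrow> 'c) \<Rightarrow> nat \<Rightarrow> (nat \<Rightarrow> nat set) set" where
  "image_tuples X n x m =
     {T \<in> {1..n} \<rightarrow>\<^sub>E Pow {1..m}. \<forall>j\<in>{1..n}. \<forall>k\<in>{1..n}. j \<noteq> k \<longrightarrow> (x j, x k) \<in> snd X \<longrightarrow>
        (\<forall>s\<in>T j. \<forall>t\<in>T k. s \<le> t)}"

lemma image_tuples_subset: "T \<in> image_tuples X n x m \<Longrightarrow> k \<in> {1..n} \<Longrightarrow> T k \<subseteq> {1..m}"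
  unfolding image_tuples_def by (blast dest: PiE_mem)

lemma image_tuples_le:
  assumes "T \<in> image_tuples X n x m" "j \<in> {1..n}" "k \<in> {1..n}" "j \<noteq> k" "(x j, x k) \<in> snd X"
    and "s \<in> T j" "t \<in> T k"
  shows "s \<le> t"
  using assms unfolding image_tuples_def by blast

definition block_maps :: "nat \<Rightarrow> (nat \<Rightarrow> 'a poset) \<Rightarrow> (nat \<times> 'a \<Rightarrow> nat) \<Rightarrow> nat \<Rightarrow> 'a \<Rightarrow> nat" where
  "block_maps n P f = (\<lambda>k\<in>{1..n}. \<lambda>p\<in>fst (P k). f (k, p))"

text \<open>
  Currying is the bijection; its inverse glues the block maps together. Grouping the tuples
  of maps on the blocks by their tuples of images turns the mixed condition between different
  blocks into the condition \<open>T \<in> image_tuples X n x m\<close> on the index of the group; within a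
  group, the blocks are independent.
\<close>

lemma bij_betw_block_maps:
  "bij_betw (block_maps n P) (order_preserving_maps (ur_operation X n x P) m)
     (\<Union>T\<in>image_tuples X n x m. \<Pi>\<^sub>E k\<in>{1..n}. maps_onto (P k) (T k))"
    (is "bij_betw _ ?M ?B")
proof (rule bij_betw_byWitness
    [where f' = "\<lambda>g. \<lambda>(k, p)\<in>(SIGMA k:{1..n}. fst (P k)). g k p"])
  let ?S = "SIGMA k:{1..n}. fst (P k)"
  let ?join = "\<lambda>g. \<lambda>(k, p)\<in>?S. g k p"
  have M: "f \<in> ?M \<longleftrightarrow> f \<in> ?S \<rightarrow>\<^sub>E {1..m} \<and>
      (\<forall>j\<in>{1..n}. \<forall>p\<in>fst (P j). \<forall>k\<in>{1..n}. \<forall>q\<in>fst (P k).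
        j = k \<and> (p, q) \<in> snd (P j) \<or> j \<noteq> k \<and> (x j, x k) \<in> snd X \<longrightarrow> f (j, p) \<le> f (k, q))" for f
    by (auto simp: order_preserving_maps_def monotone_on_def ur_operation_def Let_def)
  show "\<forall>f\<in>?M. ?join (block_maps n P f) = f"
    by (auto simp: M block_maps_def fun_eq_iff PiE_def extensional_def)
  show "\<forall>g\<in>?B. block_maps n P (?join g) = g"
  proof
    fix g assume "g \<in> ?B"
    then obtain T where g: "g \<in> (\<Pi>\<^sub>E k\<in>{1..n}. maps_onto (P k) (T k))" by blast
    have "g k \<in> extensional (fst (P k))" if "k \<in> {1..n}" for k
      using g that by (fastforce simp: maps_onto_def maps_into_def PiE_def)
    then have "block_maps n P (?join g) k = g k" for k
      using g
      by (cases "k \<in> {1..n}") (auto simp: block_maps_def fun_eq_iff extensional_def PiE_def)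
    then show "block_maps n P (?join g) = g" ..
  qed
  show "block_maps n P ` ?M \<subseteq> ?B"
  proof (rule image_subsetI)
    fix f assume f: "f \<in> ?M"
    let ?T = "\<lambda>k\<in>{1..n}. (\<lambda>p. f (k, p)) ` fst (P k)"
    have "?T \<in> image_tuples X n x m"
      using f by (fastforce simp: M image_tuples_def PiE_def Pi_def)
    moreover have "block_maps n P f \<in> (\<Pi>\<^sub>E k\<in>{1..n}. maps_onto (P k) (?T k))"
      using f by (auto simp: M block_maps_def maps_onto_def maps_into_def monotone_on_def)
    ultimately show "block_maps n P f \<in> ?B" by blast
  qed
  show "?join ` ?B \<subseteq> ?M"
  proof (rule image_subsetI)
    fix g assume "g \<in> ?B"
    then obtain T where T: "T \<in> image_tuples X n x m"
      and g: "g \<in> (\<Pi>\<^sub>E k\<in>{1..n}. maps_onto (P k) (T k))" by blast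
    have gk: "g k \<in> maps_onto (P k) (T k)" if "k \<in> {1..n}" for k
      using g that by (auto simp: PiE_def)
    have val: "g k p \<in> T k" if "k \<in> {1..n}" "p \<in> fst (P k)" for k p
      using gk[OF that(1)] that(2) by (auto simp: maps_onto_def)
    have "g k p \<in> {1..m}" if "k \<in> {1..n}" "p \<in> fst (P k)" for k p
      using val[OF that] image_tuples_subset[OF T that(1)] by blast
    moreover have "g k p \<le> g k q"
      if "k \<in> {1..n}" "p \<in> fst (P k)" "q \<in> fst (P k)" "(p, q) \<in> snd (P k)" for k p q
      using gk[OF that(1)] that by (auto simp: maps_onto_def maps_into_def monotone_on_def)
    moreover have "g j p \<le> g k q"
      if "j \<in> {1..n}" "p \<in> fst (P j)" "k \<in> {1..n}" "q \<in> fst (P k)" "j \<noteq> k" "(x j, x k) \<in> snd X"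
      for j p k q
      using image_tuples_le[OF T that(1,3,5,6)] val[OF that(1,2)] val[OF that(3,4)] by blast
    ultimately show "?join g \<in> ?M"
      unfolding M by auto
  qed
qed

lemma order_polynomial_ur_operation:
  assumes fin: "\<And>k. k \<in> {1..n} \<Longrightarrow> finite (fst (P k))"
  shows "order_polynomial (ur_operation X n x P) m =
    (\<Sum>T\<in>image_tuples X n x m. \<Prod>k\<in>{1..n}. card (maps_onto (P k) (T k)))"
proof -
  let ?G = "\<lambda>T. \<Pi>\<^sub>E k\<in>{1..n}. maps_onto (P k) (T k)"
  have finT: "finite (T k)" if "T \<in> image_tuples X n x m" "k \<in> {1..n}" for T k
    using image_tuples_subset[OF that] finite_subset by blast
  have "finite (image_tuples X n x m)"
    by (auto simp: image_tuples_def intro!: finite_PiE)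
  moreover have "\<forall>T\<in>image_tuples X n x m. finite (?G T)"
    by (auto intro!: finite_PiE finite_maps_onto fin finT)
  moreover have "?G T \<inter> ?G U = {}"
    if "T \<in> image_tuples X n x m" "U \<in> image_tuples X n x m" "T \<noteq> U" for T U
  \<comment> \<open>a tuple of maps determines its tuple of images; outside \<open>{1..n}\<close> both \<open>T\<close> and \<open>U\<close> are undefined\<close>
  proof (rule ccontr)
    assume "?G T \<inter> ?G U \<noteq> {}"
    then obtain g where "g \<in> ?G T" "g \<in> ?G U" by blast
    then have "T k = U k" if "k \<in> {1..n}" for k
      using that by (fastforce simp: PiE_def Pi_def maps_onto_def)
    moreover have "T \<in> {1..n} \<rightarrow>\<^sub>E Pow {1..m}" "U \<in> {1..n} \<rightarrow>\<^sub>E Pow {1..m}"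
      using that(1,2) by (simp_all only: image_tuples_def mem_Collect_eq)
    ultimately have "T = U"
      by (metis PiE_ext)
    with \<open>T \<noteq> U\<close> show False ..
  qed
  ultimately have "card (\<Union>T\<in>image_tuples X n x m. ?G T) = (\<Sum>T\<in>image_tuples X n x m. card (?G T))"
    by (intro card_UN_disjoint) auto
  then show ?thesis
    using bij_betw_same_card[OF bij_betw_block_maps[of n P X x m]]
    by (simp add: order_polynomial_def card_PiE)
qed

theorem theorem1p7:
  fixes X :: "'c poset" and n :: nat and x :: "nat \<Rightarrow> 'c"
    and P :: "nat \<Rightarrow> 'a poset" and Q :: "nat \<Rightarrow> 'b poset"
  assumes "finite_poset X"
    and "bij_betw x {1..n} (fst X)"
    and "\<And>i. i \<in> {1..n} \<Longrightarrow> finite_poset (P i)"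
    and "\<And>i. i \<in> {1..n} \<Longrightarrow> finite_poset (Q i)"
    and "\<And>i. i \<in> {1..n} \<Longrightarrow> P i \<sim>\<^sub>d Q i"
  shows "ur_operation X n x P \<sim>\<^sub>d ur_operation X n x Q"
proof -
  have finP: "finite (fst (P k))" and finQ: "finite (fst (Q k))" if "k \<in> {1..n}" for k
    using assms(3,4)[OF that] by (auto simp: finite_poset_def)
  have "card (maps_onto (P k) (T k)) = card (maps_onto (Q k) (T k))"
    if "T \<in> image_tuples X n x m" "k \<in> {1..n}" for T k m
  proof (rule card_maps_onto_doppelgangers)
    show "finite (T k)"
      using image_tuples_subset[OF that] finite_subset by blast
  qed (use that assms(5) finP finQ in auto)
  then have "order_polynomial (ur_operation X n x P) m = order_polynomial (ur_operation X n x Q) m" for m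
    by (simp only: order_polynomial_ur_operation finP finQ cong: sum.cong prod.cong)
  then show ?thesis
    by (simp add: doppelgangers_def fun_eq_iff)
qed

end
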